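(* Let $H$ be a fixed finite simple graph with $v$ vertices and $\ell>1$ edges, such that every vertex of $H$ lies on at least one edge, and let $0<p<1$. Consider the random simple graph on $n$ labeled vertices in which each of the $\binom n2$ possible edges appears independently with probability $p$. Then the expectation, variance and residual variance of the number $T_H$ of copies of $H$ are given, for $n\ge v$ (with all $O$-terms as $n\to\infty$), by $$\langle T_H\rangle_{n,p}=c_n p^\ell=\frac{1}{|S_H|}\Big[n^v-\frac{v(v-1)}{2}n^{v-1}\Big]p^\ell+O(n^{v-2}),$$ $$\mathrm{Var}(T_H)_{n,p}=\sum_{k=0}^{\ell}C_k\,(p^{2\ell-k}-p^{2\ell})=O(n^{2v-2}),$$ $$\mathrm{ResVar}(T_H)_{n,p}=\sum_{k=0}^{\ell}C_k\big(p^{2\ell-k}-p^{2\ell}-k(p^{2\ell-1}-p^{2\ell})\big)=C_2\,p^{2\ell-2}(1-p)^2+C_3\,p^{2\ell-3}(1-3p^2+2p^3)+O(n^{2v-4})=O(n^{2v-3}).$$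
   Context: $T_H$ is the number of copies of $H$ in the random graph, i.e. the number of (not necessarily induced) subgraphs isomorphic to $H$, and $T_e$ is the total number of edges. $\langle\cdot\rangle_{n,p}$, $\mathrm{Var}(\cdot)_{n,p}$ and $\mathrm{Cov}(\cdot,\cdot)_{n,p}$ denote expectation, variance and covariance in the independent-edge model. The residual variance of $T_H$ (the variance not explained by linear correlation with $T_e$) is $$\mathrm{ResVar}(T_H)_{n,p}=\mathrm{Var}(T_H)_{n,p}-\frac{\mathrm{Cov}(T_H,T_e)_{n,p}^2}{\mathrm{Var}(T_e)_{n,p}}.$$ $S_H$ is the group of symmetries (automorphism group) of $H$. $c_n=n(n-1)\cdots(n+1-v)/|S_H|$ is the number of copies of $H$ in the complete graph on the $n$ vertices. For $0\le k\le\ell$, $C_k=C_k(n)$ is the number of ordered pairs of copies of $H$ in the complete graph on the $n$ vertices (the two copies being distinguishable as first and second, and allowed to coincide) that share exactly $k$ edges; $C_k=0$ for $k>\ell$. The constants implied in the $O$-terms may depend on $H$ and $p$, but not on $n$. *)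

theory Defs
  imports
    "HOL-Probability.Probability"
    "HOL-Probability.Product_PMF"
    "HOL-Combinatorics.Permutations"
    "HOL-Library.Ramsey"
    "HOL-Library.Landau_Symbols"
begin

text \<open>
  A finite simple graph is a vertex set \<open>V\<close> together with a set \<open>E\<close> of two-element subsets of
  \<open>V\<close>. The random graph lives on the vertex set \<open>{..<n}\<close>, so there a graph is given by its edge
  set alone.
\<close>

definition simple_graph :: "'a set \<Rightarrow> 'a set set \<Rightarrow> bool" where
  "simple_graph V E \<longleftrightarrow> finite V \<and> E \<subseteq> nsets V 2"

definition complete_edges :: "nat \<Rightarrow> nat set set" where
  "complete_edges n = nsets {..<n} 2"

definition graph_isomorphism :: "('a \<Rightarrow> 'b) \<Rightarrow> 'a set \<Rightarrow> 'a set set \<Rightarrow> 'b set \<Rightarrow> 'b set set \<Rightarrow> bool" where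
  "graph_isomorphism f V E W F \<longleftrightarrow> bij_betw f V W \<and> (\<lambda>e. f ` e) ` E = F"

definition isomorphic_graphs :: "'a set \<Rightarrow> 'a set set \<Rightarrow> 'b set \<Rightarrow> 'b set set \<Rightarrow> bool" where
  "isomorphic_graphs V E W F \<longleftrightarrow> (\<exists>f. graph_isomorphism f V E W F)"

text \<open>
  Requiring \<open>f permutes V\<close> makes each automorphism the identity outside \<open>V\<close>, so that distinct
  elements of this set are distinct as maps on \<open>V\<close>.
\<close>

definition automorphisms :: "'a set \<Rightarrow> 'a set set \<Rightarrow> ('a \<Rightarrow> 'a) set" where
  "automorphisms V E = {f. f permutes V \<and> graph_isomorphism f V E V E}"

text \<open>
  The not necessarily induced subgraphs of the graph \<open>({..<n}, G)\<close> that are isomorphic to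
  \<open>(V, E)\<close>, each given by its vertex set and its edge set.
\<close>

definition copies :: "'a set \<Rightarrow> 'a set set \<Rightarrow> nat \<Rightarrow> nat set set \<Rightarrow> (nat set \<times> nat set set) set" where
  "copies V E n G =
     {(W, F). W \<subseteq> {..<n} \<and> F \<subseteq> G \<and> simple_graph W F \<and> isomorphic_graphs V E W F}"

definition num_copies :: "'a set \<Rightarrow> 'a set set \<Rightarrow> nat \<Rightarrow> nat set set \<Rightarrow> real" where
  "num_copies V E n G = real (card (copies V E n G))"

definition num_edges :: "nat set set \<Rightarrow> real" where
  "num_edges G = real (card G)"

definition random_graph :: "nat \<Rightarrow> real \<Rightarrow> nat set set pmf" where
  "random_graph n p =
     map_pmf (\<lambda>\<omega>. {e \<in> complete_edges n. \<omega> e})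
       (Pi_pmf (complete_edges n) False (\<lambda>_. bernoulli_pmf p))"

definition covariance :: "'b pmf \<Rightarrow> ('b \<Rightarrow> real) \<Rightarrow> ('b \<Rightarrow> real) \<Rightarrow> real" where
  "covariance M X Y =
     measure_pmf.expectation M
       (\<lambda>x. (X x - measure_pmf.expectation M X) * (Y x - measure_pmf.expectation M Y))"

definition expectation_T :: "'a set \<Rightarrow> 'a set set \<Rightarrow> real \<Rightarrow> nat \<Rightarrow> real" where
  "expectation_T V E p n = measure_pmf.expectation (random_graph n p) (num_copies V E n)"

definition variance_T :: "'a set \<Rightarrow> 'a set set \<Rightarrow> real \<Rightarrow> nat \<Rightarrow> real" where
  "variance_T V E p n = measure_pmf.variance (random_graph n p) (num_copies V E n)"

definition resvar_T :: "'a set \<Rightarrow> 'a set set \<Rightarrow> real \<Rightarrow> nat \<Rightarrow> real" where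
  "resvar_T V E p n =
     variance_T V E p n
       - (covariance (random_graph n p) (num_copies V E n) num_edges)\<^sup>2
           / measure_pmf.variance (random_graph n p) num_edges"

text \<open>The number \<open>n (n - 1) \<dots> (n + 1 - v) / |S\<^sub>H|\<close> of copies in the complete graph.\<close>

definition c_copies :: "'a set \<Rightarrow> 'a set set \<Rightarrow> nat \<Rightarrow> real" where
  "c_copies V E n =
     (\<Prod>i<card V. real n - real i) / real (card (automorphisms V E))"

definition C_pairs :: "'a set \<Rightarrow> 'a set set \<Rightarrow> nat \<Rightarrow> nat \<Rightarrow> real" where
  "C_pairs V E k n =
     real (card {(A, B). A \<in> copies V E n (complete_edges n)
                       \<and> B \<in> copies V E n (complete_edges n)
                       \<and> card (snd A \<inter> snd B) = k})"

end

theory Submission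
  imports Defs
begin

text \<open>
  \<open>T\<^sub>H\<close> and \<open>T\<^sub>e\<close> are sums of indicators \<open>F \<subseteq> G\<close> over the copies \<open>F\<close> and over the single edges, and
  two such indicators for \<open>F\<close> and \<open>F'\<close> have covariance \<open>p\<close> to the \<open>|F \<union> F'|\<close> minus \<open>p\<close> to the
  \<open>|F| + |F'|\<close>. Grouping pairs of copies by the size of their overlap gives the variance. By symmetry
  every edge of the complete graph lies in the same number \<open>d\<close> of copies, so double counting gives
  \<open>\<Sum>k. k C\<^sub>k = N d\<^sup>2\<close> and \<open>N d = c\<^sub>n l\<close> with \<open>N = n choose 2\<close>; these identify
  \<open>Cov\<^sup>2 / Var\<close> with the subtracted linear term. In the residual variance the coefficients of \<open>C\<^sub>0\<close> and
  \<open>C\<^sub>1\<close> vanish, and copies sharing many edges share many vertices, which bounds the rest.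
\<close>

section \<open>The random graph: expectations and covariances of subgraph indicators\<close>

lemma finite_complete_edges: "finite (complete_edges n)"
  unfolding complete_edges_def by (intro finite_imp_finite_nsets finite_lessThan)

lemma card_complete_edges: "card (complete_edges n) = n choose 2"
  unfolding complete_edges_def binomial_eq_nsets atLeast0LessThan ..

lemma set_pmf_random_graph: "set_pmf (random_graph n p) \<subseteq> Pow (complete_edges n)"
  unfolding random_graph_def set_map_pmf by blast

lemma integrable_random_graph:
  fixes f :: "nat set set \<Rightarrow> real"
  shows "integrable (measure_pmf (random_graph n p)) f"
  by (rule integrable_measure_pmf_finite, rule finite_subset[OF set_pmf_random_graph])
    (simp add: finite_complete_edges)

text \<open>The indicator is a product over all edges of the complete graph of factors that each
  depend on one coordinate, with the constant factor 1 for edges outside \<open>F\<close>.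
  Independence turns the expectation of this product into a product of expectations.\<close>

lemma expectation_subgraph:
  assumes "F \<subseteq> complete_edges n" "0 \<le> p" "p \<le> 1"
  shows "measure_pmf.expectation (random_graph n p) (\<lambda>G. of_bool (F \<subseteq> G)) = p ^ card F"
proof -
  let ?K = "complete_edges n"
  let ?f = "\<lambda>e b. (if e \<in> F then of_bool b else 1) :: real"
  have "of_bool (F \<subseteq> {e \<in> ?K. \<omega> e}) = (\<Prod>e\<in>?K. ?f e (\<omega> e))" for \<omega>
  proof (cases "\<forall>e\<in>F. \<omega> e")
    case True
    then have "(\<Prod>e\<in>?K. ?f e (\<omega> e)) = 1"
      by (intro prod.neutral) auto
    with True show ?thesis using assms(1) by auto
  next
    case False
    then obtain e where "e \<in> F" "\<not> \<omega> e" by auto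
    with assms(1) finite_complete_edges[of n] have "(\<Prod>e\<in>?K. ?f e (\<omega> e)) = 0"
      by (intro prod_zero) auto
    with False show ?thesis by auto
  qed
  then have "measure_pmf.expectation (random_graph n p) (\<lambda>G. of_bool (F \<subseteq> G))
      = measure_pmf.expectation (Pi_pmf ?K False (\<lambda>_. bernoulli_pmf p)) (\<lambda>\<omega>. \<Prod>e\<in>?K. ?f e (\<omega> e))"
    by (simp add: random_graph_def)
  also have "\<dots> = (\<Prod>e\<in>?K. measure_pmf.expectation (bernoulli_pmf p) (?f e))"
    by (rule expectation_prod_Pi_pmf)
      (auto simp: finite_complete_edges intro!: integrable_measure_pmf_finite)
  also have "\<dots> = (\<Prod>e\<in>?K. if e \<in> F then p else 1)"
    using assms by (intro prod.cong) auto
  also have "\<dots> = p ^ card F"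
    using assms(1) finite_complete_edges[of n]
    by (simp add: prod.If_cases Int_absorb1)
  finally show ?thesis .
qed

lemma covariance_random_graph:
  "covariance (random_graph n p) X Y =
     measure_pmf.expectation (random_graph n p) (\<lambda>G. X G * Y G)
     - measure_pmf.expectation (random_graph n p) X * measure_pmf.expectation (random_graph n p) Y"
proof -
  let ?E = "measure_pmf.expectation (random_graph n p)"
  have "(\<lambda>G. (X G - ?E X) * (Y G - ?E Y)) = (\<lambda>G. X G * Y G - ?E X * Y G - X G * ?E Y + ?E X * ?E Y)"
    by (simp add: fun_eq_iff algebra_simps)
  then show ?thesis
    by (simp add: covariance_def integrable_random_graph)
qed

lemma expectation_sum_subgraphs:
  assumes "\<And>i. i \<in> I \<Longrightarrow> \<phi> i \<subseteq> complete_edges n" "0 \<le> p" "p \<le> 1"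
  shows "measure_pmf.expectation (random_graph n p) (\<lambda>G. \<Sum>i\<in>I. of_bool (\<phi> i \<subseteq> G))
    = (\<Sum>i\<in>I. p ^ card (\<phi> i))"
  using assms by (subst Bochner_Integration.integral_sum)
    (simp_all add: integrable_random_graph expectation_subgraph)

text \<open>Bilinearity reduces this to single pairs, and the product of two indicators is the
  indicator of \<open>\<phi> i \<union> \<psi> j \<subseteq> G\<close>. Indexed families let one
  formula serve both copies, through \<open>snd\<close>, and single edges, through
  \<open>{e}\<close>.\<close>

lemma covariance_sum_subgraphs:
  assumes "\<And>i. i \<in> I \<Longrightarrow> \<phi> i \<subseteq> complete_edges n" "\<And>j. j \<in> J \<Longrightarrow> \<psi> j \<subseteq> complete_edges n"
    and "0 \<le> p" "p \<le> 1"
  shows "covariance (random_graph n p)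
       (\<lambda>G. \<Sum>i\<in>I. of_bool (\<phi> i \<subseteq> G)) (\<lambda>G. \<Sum>j\<in>J. of_bool (\<psi> j \<subseteq> G))
    = (\<Sum>i\<in>I. \<Sum>j\<in>J. p ^ card (\<phi> i \<union> \<psi> j) - p ^ (card (\<phi> i) + card (\<psi> j)))"
proof -
  have sub: "\<phi> (fst x) \<union> \<psi> (snd x) \<subseteq> complete_edges n" if "x \<in> I \<times> J" for x
    using assms(1)[of "fst x"] assms(2)[of "snd x"] that by auto
  have "(\<Sum>i\<in>I. of_bool (\<phi> i \<subseteq> G)) * (\<Sum>j\<in>J. of_bool (\<psi> j \<subseteq> G))
    = (\<Sum>x\<in>I\<times>J. of_bool (\<phi> (fst x) \<union> \<psi> (snd x) \<subseteq> G) :: real)" for G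
    unfolding sum_product sum.cartesian_product by (intro sum.cong) auto
  moreover have "measure_pmf.expectation (random_graph n p)
      (\<lambda>G. \<Sum>x\<in>I\<times>J. of_bool (\<phi> (fst x) \<union> \<psi> (snd x) \<subseteq> G))
    = (\<Sum>x\<in>I\<times>J. p ^ card (\<phi> (fst x) \<union> \<psi> (snd x)))"
    using assms(3,4) sub by (intro expectation_sum_subgraphs)
  ultimately have "covariance (random_graph n p)
       (\<lambda>G. \<Sum>i\<in>I. of_bool (\<phi> i \<subseteq> G)) (\<lambda>G. \<Sum>j\<in>J. of_bool (\<psi> j \<subseteq> G))
    = (\<Sum>x\<in>I\<times>J. p ^ card (\<phi> (fst x) \<union> \<psi> (snd x)))
      - (\<Sum>i\<in>I. p ^ card (\<phi> i)) * (\<Sum>j\<in>J. p ^ card (\<psi> j))"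
    using assms by (simp only: covariance_random_graph expectation_sum_subgraphs)
  also have "(\<Sum>x\<in>I\<times>J. p ^ card (\<phi> (fst x) \<union> \<psi> (snd x)))
    = (\<Sum>i\<in>I. \<Sum>j\<in>J. p ^ card (\<phi> i \<union> \<psi> j))"
    by (simp add: sum.cartesian_product case_prod_unfold)
  also have "\<dots> - (\<Sum>i\<in>I. p ^ card (\<phi> i)) * (\<Sum>j\<in>J. p ^ card (\<psi> j))
    = (\<Sum>i\<in>I. \<Sum>j\<in>J. p ^ card (\<phi> i \<union> \<psi> j) - p ^ (card (\<phi> i) + card (\<psi> j)))"
    by (simp add: sum_product sum_subtractf power_add)
  finally show ?thesis .
qed

lemma covariance_self: "covariance M X X = measure_pmf.variance M X"
  by (simp add: covariance_def power2_eq_square)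

section \<open>Edge and copy counts as sums of indicators\<close>

lemma num_edges_eq_sum:
  assumes "G \<subseteq> complete_edges n"
  shows "num_edges G = (\<Sum>e\<in>complete_edges n. of_bool ({e} \<subseteq> G))"
  using assms finite_complete_edges[of n]
  by (simp add: num_edges_def of_bool_def sum.If_cases Int_absorb1)

lemma num_copies_eq_sum:
  assumes "G \<subseteq> complete_edges n" "finite (copies V E n (complete_edges n))"
  shows "num_copies V E n G = (\<Sum>A\<in>copies V E n (complete_edges n). of_bool (snd A \<subseteq> G))"
proof -
  have "copies V E n G = copies V E n (complete_edges n) \<inter> {A. snd A \<subseteq> G}"
    using assms(1) by (auto simp: copies_def)
  then show ?thesis
    using assms(2) by (simp add: num_copies_def of_bool_def sum.If_cases)
qed

text \<open>The counts are rewritten as indicator sums for graphs inside the complete graph. The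
  random graph is supported on these, so agreement there is agreement almost surely.\<close>

lemma expectation_cong_random_graph:
  assumes "\<And>G. G \<subseteq> complete_edges n \<Longrightarrow> X G = Y G"
  shows "measure_pmf.expectation (random_graph n p) X = measure_pmf.expectation (random_graph n p) Y"
proof (rule integral_cong_AE)
  show "AE G in random_graph n p. X G = Y G"
    using assms set_pmf_random_graph[of n p] by (intro AE_pmfI) blast
qed simp_all

lemma covariance_cong_random_graph:
  assumes "\<And>G. G \<subseteq> complete_edges n \<Longrightarrow> X G = X' G" "\<And>G. G \<subseteq> complete_edges n \<Longrightarrow> Y G = Y' G"
  shows "covariance (random_graph n p) X Y = covariance (random_graph n p) X' Y'"
proof -
  note eq = expectation_cong_random_graph[of n X X', OF assms(1)]
    expectation_cong_random_graph[of n Y Y', OF assms(2)]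
  show ?thesis
    unfolding covariance_random_graph
    by (intro arg_cong2[where f = minus] arg_cong2[where f = times]
        expectation_cong_random_graph eq) (simp_all add: assms)
qed

section \<open>Copies and their number in the complete graph\<close>

lemma copies_subset: "copies V E n G \<subseteq> Pow {..<n} \<times> Pow G"
  by (auto simp: copies_def)

lemma finite_copies: "finite (copies V E n (complete_edges n))"
  by (rule finite_subset[OF copies_subset]) (simp add: finite_complete_edges)

text \<open>An isomorphism is injective on \<open>V\<close>, hence taking images is injective on the
  subsets of \<open>V\<close>, in particular on edges. This preserves the number of edges as well as
  that of vertices.\<close>

lemma copies_D:
  assumes "simple_graph V E" "A \<in> copies V E n G"
  shows "fst A \<subseteq> {..<n}" "snd A \<subseteq> G" "snd A \<subseteq> nsets (fst A) 2" "finite (fst A)" "finite (snd A)"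
    "card (fst A) = card V" "card (snd A) = card E"
proof -
  obtain W F where A: "A = (W, F)" by force
  with assms have WF: "W \<subseteq> {..<n}" "F \<subseteq> G" "finite W" "F \<subseteq> nsets W 2"
    by (auto simp: copies_def simple_graph_def)
  from A assms obtain f where f: "bij_betw f V W" "(\<lambda>e. f ` e) ` E = F"
    by (auto simp: copies_def isomorphic_graphs_def graph_isomorphism_def)
  have "inj_on ((`) f) (Pow V)"
    using f(1) by (simp add: bij_betw_def inj_on_image_Pow)
  then have "inj_on ((`) f) E"
    by (rule inj_on_subset) (use assms(1) in \<open>auto simp: simple_graph_def nsets_def\<close>)
  then have "card F = card E" using f(2) by (metis card_image)
  moreover have "finite F"
    using WF finite_imp_finite_nsets finite_subset by blast
  ultimately show "fst A \<subseteq> {..<n}" "snd A \<subseteq> G" "snd A \<subseteq> nsets (fst A) 2" "finite (fst A)"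
    "finite (snd A)" "card (fst A) = card V" "card (snd A) = card E"
    using A WF bij_betw_same_card[OF f(1)] by auto
qed

lemma image_nsets_2:
  assumes "inj_on f V" "e \<in> nsets V 2"
  shows "f ` e \<in> nsets (f ` V) 2"
  using assms by (auto simp: nsets_def card_image inj_on_subset)

lemma finite_automorphisms: "finite V \<Longrightarrow> finite (automorphisms V E)"
  by (rule finite_subset[OF _ finite_permutations]) (auto simp: automorphisms_def)

lemma card_automorphisms_pos:
  assumes "finite V"
  shows "card (automorphisms V E) > 0"
proof -
  have "id \<in> automorphisms V E"
    by (auto simp: automorphisms_def graph_isomorphism_def permutes_id)
  with finite_automorphisms[OF assms] show ?thesis by (auto simp: card_gt_0_iff)
qed

text \<open>The isomorphisms onto a fixed copy form a coset of the automorphism group.\<close>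

lemma card_isomorphisms:
  assumes "simple_graph V E" "isomorphic_graphs V E W F"
  shows "card {f \<in> extensional V. graph_isomorphism f V E W F} = card (automorphisms V E)"
proof -
  from assms(2) obtain f where f: "bij_betw f V W" "(\<lambda>e. f ` e) ` E = F"
    by (auto simp: isomorphic_graphs_def graph_isomorphism_def)
  have EV: "e \<subseteq> V" if "e \<in> E" for e
    using assms(1) that by (auto simp: simple_graph_def nsets_def)
  \<comment> \<open>Edges lie inside \<open>V\<close>, so it is enough that \<open>g\<close> and the
    composition of \<open>f\<close> with \<open>h\<close> agree on \<open>V\<close>; they may differ
    elsewhere.\<close>
  have img: "(\<lambda>e. g ` e) ` E = (\<lambda>e. f ` e) ` ((\<lambda>e. h ` e) ` E)"
    if "\<And>x. x \<in> V \<Longrightarrow> g x = f (h x)" for g h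
    unfolding image_image using that EV by (intro image_cong) (auto simp: subset_iff intro!: image_cong)
  have "bij_betw (\<lambda>h. restrict (f \<circ> h) V) (automorphisms V E)
      {g \<in> extensional V. graph_isomorphism g V E W F}"
  proof (rule bij_betw_imageI)
    show "inj_on (\<lambda>h. restrict (f \<circ> h) V) (automorphisms V E)"
    proof (rule inj_onI, rule ext)
      fix h k x
      assume hk: "h \<in> automorphisms V E" "k \<in> automorphisms V E"
        and eq: "restrict (f \<circ> h) V = restrict (f \<circ> k) V"
      from hk have p: "h permutes V" "k permutes V" by (auto simp: automorphisms_def)
      show "h x = k x"
      proof (cases "x \<in> V")
        case True
        with fun_cong[OF eq, of x] have "f (h x) = f (k x)" by simp
        with True p f(1) show ?thesis
          by (metis bij_betw_def inj_onD permutes_in_image)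
      qed (use p in \<open>simp add: permutes_not_in\<close>)
    qed
    show "(\<lambda>h. restrict (f \<circ> h) V) ` automorphisms V E = {g \<in> extensional V. graph_isomorphism g V E W F}"
    proof (intro equalityI subsetI)
      fix g assume "g \<in> (\<lambda>h. restrict (f \<circ> h) V) ` automorphisms V E"
      then obtain h where h: "g = restrict (f \<circ> h) V" "bij_betw h V V" "(\<lambda>e. h ` e) ` E = E"
        by (auto simp: automorphisms_def graph_isomorphism_def)
      have "bij_betw g V W"
        using bij_betw_trans[OF h(2) f(1)] bij_betw_cong[of V g "f \<circ> h"] h(1) by simp
      with img[of g h] h f show "g \<in> {g \<in> extensional V. graph_isomorphism g V E W F}"
        by (simp add: graph_isomorphism_def)
    next
      fix g assume "g \<in> {g \<in> extensional V. graph_isomorphism g V E W F}"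
      then have g: "g \<in> extensional V" "bij_betw g V W" "(\<lambda>e. g ` e) ` E = F"
        by (auto simp: graph_isomorphism_def)
      \<comment> \<open>The preimage of \<open>g\<close> is the inverse of \<open>f\<close> after
        \<open>g\<close>, continued by the identity outside \<open>V\<close> so that it permutes
        \<open>V\<close>.\<close>
      define h where "h x = (if x \<in> V then inv_into V f (g x) else x)" for x
      have "bij_betw (inv_into V f \<circ> g) V V"
        by (rule bij_betw_trans[OF g(2) bij_betw_inv_into[OF f(1)]])
      then have bh: "bij_betw h V V"
        using bij_betw_cong[of V h "inv_into V f \<circ> g"] by (simp add: h_def)
      have perm: "h permutes V"
        by (rule bij_imp_permutes[OF bh]) (simp add: h_def)
      have fh: "f (h x) = g x" if "x \<in> V" for x
      proof -
        have "g x \<in> f ` V" using that f(1) g(2) by (auto simp: bij_betw_def)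
        with that show ?thesis by (simp add: h_def f_inv_into_f)
      qed
      have sub: "(\<lambda>e. h ` e) ` E \<subseteq> Pow V"
        using EV bij_betw_imp_surj_on[OF bh] by fastforce
      \<comment> \<open>Both \<open>g\<close> and \<open>f\<close> carry \<open>E\<close> to
        \<open>F\<close>. Taking images under \<open>f\<close> is injective on \<open>Pow V\<close>,
        which contains all edges involved, so \<open>f\<close> can be cancelled and \<open>h\<close>
        preserves \<open>E\<close>.\<close>
      have "(\<lambda>e. f ` e) ` ((\<lambda>e. h ` e) ` E) = (\<lambda>e. f ` e) ` E"
        using img[of g h] fh f(2) g(3) by auto
      moreover have "inj_on ((`) f) (Pow V)"
        using f(1) by (simp add: bij_betw_def inj_on_image_Pow)
      ultimately have "(\<lambda>e. h ` e) ` E = E"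
        using sub EV by (subst (asm) inj_on_image_eq_iff) auto
      with perm bh have "h \<in> automorphisms V E"
        by (simp add: automorphisms_def graph_isomorphism_def)
      moreover have "g = restrict (f \<circ> h) V"
        using g(1) fh by (auto simp: extensional_def)
      ultimately show "g \<in> (\<lambda>h. restrict (f \<circ> h) V) ` automorphisms V E" by blast
    qed
  qed
  then show ?thesis by (rule bij_betw_same_card[symmetric])
qed

text \<open>Each injection of \<open>V\<close> into \<open>{..<n}\<close> is sent to its image copy.
  The fibre over a copy consists of the isomorphisms onto it, so all fibres have the size of the
  automorphism group, while the injections are counted by a falling factorial.\<close>

lemma card_copies:
  assumes "simple_graph V E"
  shows "real (card (copies V E n (complete_edges n))) = c_copies V E n"
proof -
  let ?S = "copies V E n (complete_edges n)"
  let ?I = "{f \<in> V \<rightarrow>\<^sub>E {..<n}. inj_on f V}"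
  let ?\<Phi> = "\<lambda>f. (f ` V, (\<lambda>e. f ` e) ` E)"
  have finV: "finite V" and EV: "E \<subseteq> nsets V 2"
    using assms by (auto simp: simple_graph_def)
  have finI: "finite ?I"
    by (rule finite_subset[of _ "V \<rightarrow>\<^sub>E {..<n}"]) (auto intro: finite_PiE finV)
  have sub: "?\<Phi> ` ?I \<subseteq> ?S"
  proof (rule image_subsetI)
    fix f assume f: "f \<in> ?I"
    have 1: "f ` e \<in> nsets (f ` V) 2" if "e \<in> E" for e
      using f EV that by (intro image_nsets_2) auto
    have 2: "nsets (f ` V) 2 \<subseteq> complete_edges n"
      unfolding complete_edges_def using f by (intro nsets_mono) auto
    have "isomorphic_graphs V E (f ` V) ((\<lambda>e. f ` e) ` E)"
      using f by (auto simp: isomorphic_graphs_def graph_isomorphism_def bij_betw_def)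
    with f 1 2 finV show "?\<Phi> f \<in> ?S"
      by (auto simp: copies_def simple_graph_def)
  qed
  have fibre: "card {f \<in> ?I. ?\<Phi> f = A} = card (automorphisms V E)" if "A \<in> ?S" for A
  proof -
    obtain W F where A: "A = (W, F)" by force
    with that have WF: "W \<subseteq> {..<n}" "isomorphic_graphs V E W F" by (auto simp: copies_def)
    have "{f \<in> ?I. ?\<Phi> f = A} = {f \<in> extensional V. graph_isomorphism f V E W F}"
      using WF(1) by (auto simp: A graph_isomorphism_def bij_betw_def PiE_def)
    with card_isomorphisms[OF assms WF(2)] show ?thesis by simp
  qed
  have "card ?I = (\<Sum>A\<in>?S. card {f \<in> ?I. ?\<Phi> f = A})"
    using sum.group[OF finI finite_copies sub, of "\<lambda>_. 1::nat"] by simp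
  also have "\<dots> = card ?S * card (automorphisms V E)"
    using fibre by simp
  finally have "card ?S * card (automorphisms V E) = card ?I" ..
  also have "card ?I = (\<Prod>i<card V. n - i)"
    using card_inj_on_subset_funcset[OF finV, of "{..<n}" V] by (simp add: atLeast0LessThan)
  also have "real \<dots> = (\<Prod>i<card V. real n - real i)"
  proof (cases "card V \<le> n")
    \<comment> \<open>If \<open>n < card V\<close>, both products contain the factor with
      \<open>i = n\<close>, which is zero, so truncated subtraction does no harm.\<close>
    case False
    then have "(\<Prod>i<card V. n - i) = 0" "(\<Prod>i<card V. real n - real i) = 0"
      by (auto intro!: prod_zero bexI[of _ n])
    then show ?thesis by (simp only: of_nat_0)
  qed (simp add: of_nat_diff)
  finally have "real (card ?S) * real (card (automorphisms V E)) = (\<Prod>i<card V. real n - real i)"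
    by simp
  then show ?thesis
    using card_automorphisms_pos[OF finV, of E] by (simp add: c_copies_def field_simps)
qed

section \<open>Symmetry of the complete graph and double counting\<close>

text \<open>A bijection from \<open>A\<close> onto \<open>B\<close> is glued to one between the
  complements and continued by the identity outside \<open>S\<close>. For two edges it yields a
  vertex permutation that moves one to the other.\<close>

lemma ex_permutes_image_eq:
  assumes "finite S" "A \<subseteq> S" "B \<subseteq> S" "card A = card B"
  shows "\<exists>f. f permutes S \<and> f ` A = B"
proof -
  have fin: "finite A" "finite B" using assms finite_subset by auto
  then obtain f where f: "bij_betw f A B"
    using assms(4) finite_same_card_bij by blast
  have "card (S - A) = card (S - B)"
    using assms fin by (simp add: card_Diff_subset)
  then obtain g where g: "bij_betw g (S - A) (S - B)"
    using assms(1) finite_same_card_bij[of "S - A" "S - B"] by auto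
  define h where "h x = (if x \<in> A then f x else if x \<in> S then g x else x)" for x
  have "bij_betw (\<lambda>x. if x \<in> A then f x else g x) (A \<union> (S - A)) (B \<union> (S - B))"
    by (rule bij_betw_disjoint_Un[OF f g]) auto
  moreover have "A \<union> (S - A) = S" "B \<union> (S - B) = S" using assms by auto
  ultimately have "bij_betw h S S"
    using bij_betw_cong[of S h "\<lambda>x. if x \<in> A then f x else g x"] by (simp add: h_def)
  then have "h permutes S"
    by (rule bij_imp_permutes) (use assms(2) in \<open>auto simp: h_def\<close>)
  moreover have "h ` A = B"
    using f by (auto simp: h_def bij_betw_def)
  ultimately show ?thesis by blast
qed

text \<open>A vertex permutation taking \<open>e\<close> to \<open>e'\<close> maps copies through
  \<open>e\<close> injectively to copies through \<open>e'\<close>. Exchanging the two edges gives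
  the reverse inequality, hence equality.\<close>

lemma card_copies_containing_le:
  assumes "e \<in> complete_edges n" "e' \<in> complete_edges n"
  shows "card {A \<in> copies V E n (complete_edges n). e \<in> snd A}
    \<le> card {A \<in> copies V E n (complete_edges n). e' \<in> snd A}" (is "card ?X \<le> card ?Y")
proof -
  from assms have "e \<subseteq> {..<n}" "e' \<subseteq> {..<n}" "card e = card e'"
    by (auto simp: complete_edges_def nsets_def)
  then obtain h where h: "h permutes {..<n}" "h ` e = e'"
    using ex_permutes_image_eq[of "{..<n}" e e'] by auto
  let ?h = "\<lambda>A. (h ` fst A, (\<lambda>e. h ` e) ` snd A)"
  have inj: "inj h" using h(1) by (rule permutes_inj)
  have "inj_on ?h ?X"
    by (rule inj_onI) (use inj in \<open>auto simp: inj_image_eq_iff prod_eq_iff inj_on_image\<close>)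
  moreover have "?h ` ?X \<subseteq> ?Y"
  proof (rule image_subsetI)
    fix A assume A: "A \<in> ?X"
    obtain W F where WF: "A = (W, F)" by force
    from A WF obtain f where f: "bij_betw f V W" "(\<lambda>e. f ` e) ` E = F"
      and W: "W \<subseteq> {..<n}" "finite W" "F \<subseteq> nsets W 2" "e \<in> F"
      by (auto simp: copies_def isomorphic_graphs_def graph_isomorphism_def simple_graph_def)
    have hW: "h ` W \<subseteq> {..<n}" using permutes_image[OF h(1)] W(1) by auto
    have hF: "(\<lambda>e. h ` e) ` F \<subseteq> nsets (h ` W) 2"
      using W(3) inj by (auto intro!: image_nsets_2 simp: inj_on_subset[OF inj])
    have "graph_isomorphism (h \<circ> f) V E (h ` W) ((\<lambda>e. h ` e) ` F)"
      unfolding graph_isomorphism_def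
      using bij_betw_trans[OF f(1) inj_on_imp_bij_betw[OF inj_on_subset[OF inj subset_UNIV]]] f(2)
      by (auto simp: image_image image_comp)
    then show "?h A \<in> ?Y"
      using hW hF W h(2) nsets_mono[OF hW, of 2]
      by (auto simp: WF copies_def isomorphic_graphs_def simple_graph_def complete_edges_def)
  qed
  ultimately show ?thesis
    by (intro card_inj_on_le[of ?h]) (simp_all add: finite_copies)
qed

text \<open>Incidences between edges and copies are counted in two ways: every edge contributes the
  same number, and every copy contributes \<open>card E\<close>.\<close>

lemma card_copies_containing:
  assumes "simple_graph V E" "e \<in> complete_edges n"
  shows "card {A \<in> copies V E n (complete_edges n). e \<in> snd A} * (n choose 2)
    = card (copies V E n (complete_edges n)) * card E"
proof -
  let ?S = "copies V E n (complete_edges n)" and ?K = "complete_edges n"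
  have "(\<Sum>e'\<in>?K. card {A \<in> ?S. e' \<in> snd A}) = (\<Sum>e'\<in>?K. card {A \<in> ?S. e \<in> snd A})"
    by (intro sum.cong refl antisym card_copies_containing_le assms(2))
  then have "card {A \<in> ?S. e \<in> snd A} * (n choose 2) = (\<Sum>e'\<in>?K. card {A \<in> ?S. e' \<in> snd A})"
    by (simp add: card_complete_edges)
  also have "\<dots> = (\<Sum>e'\<in>?K. \<Sum>A\<in>?S. of_bool (e' \<in> snd A))"
    by (simp add: finite_copies of_bool_def sum.If_cases Int_def)
  also have "\<dots> = (\<Sum>A\<in>?S. \<Sum>e'\<in>?K. of_bool (e' \<in> snd A))"
    by (rule sum.swap)
  also have "\<dots> = (\<Sum>A\<in>?S. card E)"
  proof (rule sum.cong[OF refl])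
    fix A assume "A \<in> ?S"
    with copies_D[OF assms(1)] have "snd A \<subseteq> ?K" "card (snd A) = card E" by auto
    then show "(\<Sum>e'\<in>?K. of_bool (e' \<in> snd A)) = card E"
      using finite_complete_edges[of n] by (simp add: of_bool_def sum.If_cases Int_absorb1)
  qed
  finally show ?thesis by simp
qed

text \<open>Both sides count triples of two copies and an edge common to them; for a fixed edge the
  two copies are chosen independently, whence the square.\<close>

lemma sum_card_inter_copies:
  "(\<Sum>A\<in>copies V E n (complete_edges n). \<Sum>B\<in>copies V E n (complete_edges n). card (snd A \<inter> snd B))
    = (\<Sum>e\<in>complete_edges n. (card {A \<in> copies V E n (complete_edges n). e \<in> snd A})\<^sup>2)"
proof -
  let ?S = "copies V E n (complete_edges n)" and ?K = "complete_edges n"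
  have *: "card (snd A \<inter> snd B) = (\<Sum>e\<in>?K. of_bool (e \<in> snd A) * of_bool (e \<in> snd B))"
    if "A \<in> ?S" for A B
  proof -
    have "?K \<inter> {e. e \<in> snd A \<and> e \<in> snd B} = snd A \<inter> snd B"
      using that by (auto simp: copies_def)
    moreover have "(\<Sum>e\<in>?K. of_bool (e \<in> snd A) * of_bool (e \<in> snd B))
      = (\<Sum>e\<in>?K. if e \<in> snd A \<and> e \<in> snd B then 1 else 0 :: nat)"
      by (rule sum.cong) auto
    ultimately show ?thesis
      by (simp add: finite_complete_edges sum.If_cases)
  qed
  have "(\<Sum>A\<in>?S. \<Sum>B\<in>?S. card (snd A \<inter> snd B))
    = (\<Sum>A\<in>?S. \<Sum>B\<in>?S. \<Sum>e\<in>?K. of_bool (e \<in> snd A) * of_bool (e \<in> snd B))"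
    by (rule sum.cong[OF refl], rule sum.cong[OF refl], rule *)
  also have "\<dots> = (\<Sum>A\<in>?S. \<Sum>e\<in>?K. \<Sum>B\<in>?S. of_bool (e \<in> snd A) * of_bool (e \<in> snd B))"
    by (intro sum.cong refl sum.swap)
  also have "\<dots> = (\<Sum>e\<in>?K. \<Sum>A\<in>?S. \<Sum>B\<in>?S. of_bool (e \<in> snd A) * of_bool (e \<in> snd B))"
    by (rule sum.swap)
  also have "\<dots> = (\<Sum>e\<in>?K. (\<Sum>A\<in>?S. of_bool (e \<in> snd A))\<^sup>2)"
    by (simp add: power2_eq_square sum_product)
  finally show ?thesis
    by (simp add: finite_copies of_bool_def sum.If_cases Int_def)
qed

text \<open>The weight \<open>g\<close> is left free: it is a difference of powers of
  \<open>p\<close> for the variance and the overlap itself for the sum of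
  \<open>k * C_pairs V E k n\<close>.\<close>

lemma sum_pairs_of_copies:
  assumes "simple_graph V E"
  shows "(\<Sum>A\<in>copies V E n (complete_edges n). \<Sum>B\<in>copies V E n (complete_edges n).
      g (card (snd A \<inter> snd B))) = (\<Sum>k=0..card E. C_pairs V E k n * g k)"
proof -
  let ?S = "copies V E n (complete_edges n)"
  let ?c = "\<lambda>x. card (snd (fst x) \<inter> snd (snd x))"
  have "?c ` (?S \<times> ?S) \<subseteq> {0..card E}"
    using copies_D(5,7)[OF assms] by (force intro: order.trans[OF card_mono])
  then have "(\<Sum>x\<in>?S\<times>?S. g (?c x)) = (\<Sum>k=0..card E. \<Sum>x | x \<in> ?S\<times>?S \<and> ?c x = k. g (?c x))"
    by (intro sum.group[symmetric]) (auto simp: finite_copies)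
  also have "\<dots> = (\<Sum>k=0..card E. C_pairs V E k n * g k)"
  proof (rule sum.cong[OF refl])
    fix k
    have "{x \<in> ?S\<times>?S. ?c x = k} = {(A, B). A \<in> ?S \<and> B \<in> ?S \<and> card (snd A \<inter> snd B) = k}"
      by auto
    moreover have "(\<Sum>x | x \<in> ?S\<times>?S \<and> ?c x = k. g (?c x)) = (\<Sum>x | x \<in> ?S\<times>?S \<and> ?c x = k. g k)"
      by (rule sum.cong) auto
    ultimately show "(\<Sum>x | x \<in> ?S\<times>?S \<and> ?c x = k. g (?c x)) = C_pairs V E k n * g k"
      by (simp add: C_pairs_def)
  qed
  finally show ?thesis by (simp add: sum.cartesian_product case_prod_unfold)
qed

section \<open>Growth of the number of overlapping pairs\<close>

text \<open>The joint vertex set is listed by a word of length \<open>m\<close>, for which there are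
  \<open>n ^ m\<close> choices. Each word carries a number of pairs of vertex and edge sets that is
  bounded independently of \<open>n\<close>.\<close>

lemma card_pairs_of_copies_le:
  assumes "simple_graph V E" "V \<noteq> {}"
  shows "card {(A, B). A \<in> copies V E n G \<and> B \<in> copies V E n G \<and> card (fst A \<union> fst B) \<le> m}
    \<le> (2 ^ m * 2 ^ 2 ^ m)\<^sup>2 * n ^ m" (is "card ?P \<le> _")
proof -
  let ?L = "{xs. set xs \<subseteq> {..<n} \<and> length xs = m}"
  let ?Q = "\<lambda>xs. (Pow (set xs) \<times> Pow (Pow (set xs))) \<times> (Pow (set xs) \<times> Pow (Pow (set xs)))"
  have sub: "?P \<subseteq> (\<Union>xs\<in>?L. ?Q xs)"
  proof
    fix x assume x: "x \<in> ?P"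
    obtain W F W' F' where x_eq: "x = ((W, F), (W', F'))" by (metis prod.exhaust)
    with x have A: "(W, F) \<in> copies V E n G" "(W', F') \<in> copies V E n G" and m: "card (W \<union> W') \<le> m"
      by auto
    note D = copies_D[OF assms(1) A(1), simplified] copies_D[OF assms(1) A(2), simplified]
    have "finite V" using assms(1) by (simp add: simple_graph_def)
    with D(6) assms(2) have ne: "W \<union> W' \<noteq> {}" by auto
    obtain ys where ys: "set ys = W \<union> W'" "distinct ys"
      using finite_distinct_list[of "W \<union> W'"] D by auto
    then have len: "length ys \<le> m" using m distinct_card[of ys] by simp
    \<comment> \<open>Repeating the first vertex pads the list to length exactly \<open>m\<close>
      without changing its set; this is where the joint vertex set has to be nonempty.\<close>
    define xs where "xs = ys @ replicate (m - length ys) (hd ys)"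
    have "ys \<noteq> []" using ne ys(1) by auto
    then have set_xs: "set xs = W \<union> W'" using ys(1) by (auto simp: xs_def)
    have "xs \<in> ?L" using D(1,8) set_xs len by (auto simp: xs_def)
    moreover have "x \<in> ?Q xs" using D(3,10) by (auto simp: x_eq set_xs nsets_def)
    ultimately show "x \<in> (\<Union>xs\<in>?L. ?Q xs)" by blast
  qed
  have finL: "finite ?L" by (rule finite_lists_length_eq) simp
  have "card ?P \<le> card (\<Union>xs\<in>?L. ?Q xs)"
    using finL by (intro card_mono[OF _ sub]) auto
  also have "\<dots> \<le> (\<Sum>xs\<in>?L. card (?Q xs))"
    by (rule card_UN_le[OF finL])
  also have "\<dots> \<le> (\<Sum>xs\<in>?L. (2 ^ m * 2 ^ 2 ^ m)\<^sup>2)"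
  proof (rule sum_mono)
    fix xs assume "xs \<in> ?L"
    then have "card (set xs) \<le> m" using card_length by auto
    then have "2 ^ card (set xs) * 2 ^ 2 ^ card (set xs) \<le> (2 ^ m * 2 ^ 2 ^ m :: nat)"
      by (intro mult_mono power_increasing) auto
    then have "(2 ^ card (set xs) * 2 ^ 2 ^ card (set xs))\<^sup>2 \<le> (2 ^ m * 2 ^ 2 ^ m :: nat)\<^sup>2"
      by (rule power_mono) simp
    then show "card (?Q xs) \<le> (2 ^ m * 2 ^ 2 ^ m)\<^sup>2"
      by (simp add: card_cartesian_product card_Pow power2_eq_square)
  qed
  also have "\<dots> = (2 ^ m * 2 ^ 2 ^ m)\<^sup>2 * n ^ m"
    by (simp add: card_lists_length_eq)
  finally show ?thesis .
qed

text \<open>A shared edge has both ends in both vertex sets, so it is a pair of shared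
  vertices.\<close>

lemma card_inter_nsets_le:
  assumes "F \<subseteq> nsets W 2" "F' \<subseteq> nsets W' 2" "finite W"
  shows "card (F \<inter> F') \<le> card (W \<inter> W') choose 2"
proof -
  have "F \<inter> F' \<subseteq> nsets (W \<inter> W') 2"
    using assms by (auto simp: nsets_def)
  then have "card (F \<inter> F') \<le> card (nsets (W \<inter> W') 2)"
    using assms(3) by (intro card_mono) (auto intro: finite_imp_finite_nsets)
  then show ?thesis by (simp add: card_nsets)
qed

text \<open>Two copies sharing more than \<open>(j - 1) choose 2\<close> edges share at least \<open>j\<close> vertices, so
  together they span at most \<open>2 v - j\<close> vertices.\<close>

lemma C_pairs_bigo:
  assumes "simple_graph V E" "V \<noteq> {}" "(j - 1) choose 2 < k"
  shows "C_pairs V E k \<in> O(\<lambda>n. real n ^ (2 * card V - j))"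
proof (rule bigoI)
  define m where "m = 2 * card V - j"
  let ?P = "\<lambda>n. {(A, B). A \<in> copies V E n (complete_edges n) \<and> B \<in> copies V E n (complete_edges n)
      \<and> card (fst A \<union> fst B) \<le> m}"
  show "\<forall>\<^sub>F n in sequentially. norm (C_pairs V E k n)
      \<le> real ((2 ^ m * 2 ^ 2 ^ m)\<^sup>2) * norm (real n ^ (2 * card V - j))"
  proof (rule always_eventually, rule allI)
    fix n
    let ?S = "copies V E n (complete_edges n)"
    have "{(A, B). A \<in> ?S \<and> B \<in> ?S \<and> card (snd A \<inter> snd B) = k} \<subseteq> ?P n"
    proof clarify
      fix W F W' F'
      assume A: "(W, F) \<in> ?S" "(W', F') \<in> ?S" and k: "k = card (snd (W, F) \<inter> snd (W', F'))"
      note D = copies_D[OF assms(1) A(1), simplified] copies_D[OF assms(1) A(2), simplified]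
      have "(j - 1) choose 2 < card (W \<inter> W') choose 2"
        using card_inter_nsets_le[OF D(3,10,4)] k assms(3) by simp
      then have "\<not> card (W \<inter> W') \<le> j - 1"
        using binomial_right_mono[of "card (W \<inter> W')" "j - 1" 2] by linarith
      moreover have "card (W \<union> W') + card (W \<inter> W') = card W + card W'"
        using card_Un_Int[OF D(4,11)] by simp
      ultimately show "card (fst (W, F) \<union> fst (W', F')) \<le> m"
        using D(6,13) by (simp add: m_def)
    qed
    moreover have "finite (?P n)"
      by (rule finite_subset[of _ "?S \<times> ?S"]) (auto simp: finite_copies)
    ultimately have "card {(A, B). A \<in> ?S \<and> B \<in> ?S \<and> card (snd A \<inter> snd B) = k} \<le> card (?P n)"
      by (rule card_mono[rotated])
    also have "\<dots> \<le> (2 ^ m * 2 ^ 2 ^ m)\<^sup>2 * n ^ m"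
      by (rule card_pairs_of_copies_le[OF assms(1,2)])
    finally have "C_pairs V E k n \<le> real ((2 ^ m * 2 ^ 2 ^ m)\<^sup>2 * n ^ m)"
      unfolding C_pairs_def of_nat_le_iff .
    then show "norm (C_pairs V E k n) \<le> real ((2 ^ m * 2 ^ 2 ^ m)\<^sup>2) * norm (real n ^ (2 * card V - j))"
      by (simp add: m_def C_pairs_def)
  qed
qed

section \<open>Second-order expansion of the falling factorial\<close>

text \<open>Induction multiplies by one factor at a time. Counting the factors as
  \<open>m + 2\<close> keeps the exponents \<open>m + 1\<close> and \<open>m\<close> free of
  truncated subtraction.\<close>

lemma falling_factorial_bigo:
  "(\<lambda>n. (\<Prod>i<m + 2. real n - real i)
      - (real n ^ (m + 2) - real (m + 2) * (real (m + 2) - 1) / 2 * real n ^ (m + 1)))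
    \<in> O(\<lambda>n. real n ^ m)"
proof (induction m)
  case 0
  have "(\<lambda>n. (\<Prod>i<0 + 2. real n - real i)
      - (real n ^ (0 + 2) - real (0 + 2) * (real (0 + 2) - 1) / 2 * real n ^ (0 + 1))) = (\<lambda>n. 0)"
    by (simp add: fun_eq_iff numeral_2_eq_2 algebra_simps)
  then show ?case by simp
next
  case (Suc m)
  let ?R = "\<lambda>m n. (\<Prod>i<m + 2. real n - real i)
      - (real n ^ (m + 2) - real (m + 2) * (real (m + 2) - 1) / 2 * real n ^ (m + 1))"
  \<comment> \<open>With \<open>w = m + 2\<close>, multiplying by \<open>n - w\<close> raises the
    second coefficient from \<open>w * (w - 1) / 2\<close> to \<open>(w + 1) * w / 2\<close>. What
    remains besides the old error is the old coefficient times \<open>w\<close>, which is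
    \<open>?c\<close>.\<close>
  let ?c = "real (m + 2) * (real (m + 2) * (real (m + 2) - 1) / 2)"
  have "?R (Suc m) n = ?R m n * (real n - real (m + 2)) + ?c * real n ^ Suc m" for n
    by (simp add: field_simps)
  moreover have "(\<lambda>n. ?R m n * (real n - real (m + 2))) \<in> O(\<lambda>n. real n ^ m * real n)"
    by (intro landau_o.big.mult Suc.IH) real_asymp
  moreover have "(\<lambda>n. ?c * real n ^ Suc m) \<in> O(\<lambda>n. real n ^ Suc m)"
    by simp
  ultimately show ?case
    by (simp add: mult.commute sum_in_bigo)
qed

section \<open>Exact formulas for expectation, variance and residual variance\<close>

lemma expectation_T_eq:
  assumes "simple_graph V E" "0 \<le> p" "p \<le> 1"
  shows "expectation_T V E p n = c_copies V E n * p ^ card E"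
proof -
  let ?S = "copies V E n (complete_edges n)"
  have "expectation_T V E p n = measure_pmf.expectation (random_graph n p) (\<lambda>G. \<Sum>A\<in>?S. of_bool (snd A \<subseteq> G))"
    unfolding expectation_T_def
    by (rule expectation_cong_random_graph) (simp add: num_copies_eq_sum finite_copies)
  also have "\<dots> = (\<Sum>A\<in>?S. p ^ card (snd A))"
    using assms copies_D(2)[OF assms(1)] by (intro expectation_sum_subgraphs) auto
  also have "\<dots> = (\<Sum>A\<in>?S. p ^ card E)"
    using copies_D(7)[OF assms(1)] by (intro sum.cong) auto
  finally show ?thesis using card_copies[OF assms(1), of n] by simp
qed

text \<open>Two copies with \<open>k\<close> common edges have a union of
  \<open>2 * card E - k\<close> edges; the pairs are then grouped by \<open>k\<close>.\<close>

lemma variance_T_eq: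
  assumes "simple_graph V E" "0 \<le> p" "p \<le> 1"
  shows "variance_T V E p n = (\<Sum>k=0..card E. C_pairs V E k n * (p ^ (2 * card E - k) - p ^ (2 * card E)))"
proof -
  let ?S = "copies V E n (complete_edges n)"
  have "variance_T V E p n = covariance (random_graph n p) (num_copies V E n) (num_copies V E n)"
    unfolding variance_T_def covariance_self ..
  also have "\<dots> = covariance (random_graph n p) (\<lambda>G. \<Sum>A\<in>?S. of_bool (snd A \<subseteq> G)) (\<lambda>G. \<Sum>A\<in>?S. of_bool (snd A \<subseteq> G))"
    by (rule covariance_cong_random_graph) (simp_all add: num_copies_eq_sum finite_copies)
  also have "\<dots> = (\<Sum>A\<in>?S. \<Sum>B\<in>?S. p ^ card (snd A \<union> snd B) - p ^ (card (snd A) + card (snd B)))"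
    using assms copies_D(2)[OF assms(1)] by (intro covariance_sum_subgraphs) auto
  also have "\<dots> = (\<Sum>A\<in>?S. \<Sum>B\<in>?S. p ^ (2 * card E - card (snd A \<inter> snd B)) - p ^ (2 * card E))"
  proof (intro sum.cong refl)
    fix A B assume AB: "A \<in> ?S" "B \<in> ?S"
    note D = copies_D[OF assms(1) AB(1)] copies_D[OF assms(1) AB(2)]
    have "card (snd A \<union> snd B) = 2 * card E - card (snd A \<inter> snd B)"
      using card_Un_Int[OF D(5,12)] D(7,14) by simp
    then show "p ^ card (snd A \<union> snd B) - p ^ (card (snd A) + card (snd B))
      = p ^ (2 * card E - card (snd A \<inter> snd B)) - p ^ (2 * card E)"
      using D(7,14) by (simp add: mult_2)
  qed
  also have "\<dots> = (\<Sum>k=0..card E. C_pairs V E k n * (p ^ (2 * card E - k) - p ^ (2 * card E)))"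
    by (rule sum_pairs_of_copies[OF assms(1)])
  finally show ?thesis .
qed

text \<open>An edge outside a copy is independent of it and contributes 0; each of the
  \<open>card E\<close> edges inside contributes
  \<open>p ^ card E - p ^ (card E + 1)\<close>.\<close>

lemma covariance_num_copies_num_edges:
  assumes "simple_graph V E" "0 \<le> p" "p \<le> 1"
  shows "covariance (random_graph n p) (num_copies V E n) num_edges
    = real (card (copies V E n (complete_edges n)) * card E) * (p ^ card E * (1 - p))"
proof -
  let ?S = "copies V E n (complete_edges n)" and ?K = "complete_edges n"
  have "covariance (random_graph n p) (num_copies V E n) num_edges
    = covariance (random_graph n p) (\<lambda>G. \<Sum>A\<in>?S. of_bool (snd A \<subseteq> G)) (\<lambda>G. \<Sum>e\<in>?K. of_bool ({e} \<subseteq> G))"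
    by (rule covariance_cong_random_graph) (simp_all only: num_copies_eq_sum finite_copies num_edges_eq_sum)
  also have "\<dots> = (\<Sum>A\<in>?S. \<Sum>e\<in>?K. p ^ card (snd A \<union> {e}) - p ^ (card (snd A) + card {e}))"
    using assms copies_D(2)[OF assms(1)] by (intro covariance_sum_subgraphs) auto
  also have "\<dots> = (\<Sum>A\<in>?S. real (card E) * (p ^ card E * (1 - p)))"
  proof (rule sum.cong[OF refl])
    fix A assume A: "A \<in> ?S"
    note D = copies_D[OF assms(1) A]
    have "(\<Sum>e\<in>?K. p ^ card (snd A \<union> {e}) - p ^ (card (snd A) + card {e}))
      = (\<Sum>e\<in>?K. if e \<in> snd A then p ^ card E * (1 - p) else 0)"
      using D by (intro sum.cong refl) (auto simp: insert_absorb algebra_simps)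
    also have "\<dots> = real (card E) * (p ^ card E * (1 - p))"
      using D by (simp add: sum.If_cases finite_complete_edges Int_absorb1)
    finally show "(\<Sum>e\<in>?K. p ^ card (snd A \<union> {e}) - p ^ (card (snd A) + card {e}))
      = real (card E) * (p ^ card E * (1 - p))" .
  qed
  finally show ?thesis by simp
qed

lemma variance_num_edges:
  assumes "0 \<le> p" "p \<le> 1"
  shows "measure_pmf.variance (random_graph n p) num_edges = real (n choose 2) * (p * (1 - p))"
proof -
  let ?K = "complete_edges n"
  have "measure_pmf.variance (random_graph n p) num_edges
    = covariance (random_graph n p) (\<lambda>G. \<Sum>e\<in>?K. of_bool ({e} \<subseteq> G)) (\<lambda>G. \<Sum>e\<in>?K. of_bool ({e} \<subseteq> G))"
    unfolding covariance_self[symmetric]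
    by (rule covariance_cong_random_graph) (simp_all only: num_edges_eq_sum)
  also have "\<dots> = (\<Sum>e\<in>?K. \<Sum>e'\<in>?K. p ^ card ({e} \<union> {e'}) - p ^ (card {e} + card {e'}))"
    using assms by (intro covariance_sum_subgraphs) auto
  also have "\<dots> = (\<Sum>e\<in>?K. \<Sum>e'\<in>?K. if e' = e then p * (1 - p) else 0)"
    by (intro sum.cong refl) (auto simp: algebra_simps card_insert_if)
  also have "\<dots> = real (n choose 2) * (p * (1 - p))"
    by (simp add: finite_complete_edges card_complete_edges)
  finally show ?thesis .
qed

text \<open>With \<open>d\<close> copies through each edge and \<open>?N\<close> edges, the
  covariance is \<open>?N * d * (p ^ card E * (1 - p))\<close> and the edge variance is
  \<open>?N * (p * (1 - p))\<close>. Their quotient contains the factor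
  \<open>?N * d\<^sup>2\<close>, which is the sum of \<open>k * C_pairs V E k n\<close>. The bound
  \<open>n \<ge> 2\<close> makes \<open>?N\<close> positive, so the division is genuine.\<close>

lemma resvar_T_eq:
  assumes "simple_graph V E" "card E > 0" "n \<ge> 2" "0 < p" "p < 1"
  shows "resvar_T V E p n
    = (\<Sum>k=0..card E. C_pairs V E k n * (p ^ (2 * card E - k) - p ^ (2 * card E)
        - real k * (p ^ (2 * card E - 1) - p ^ (2 * card E))))"
proof -
  let ?S = "copies V E n (complete_edges n)" and ?K = "complete_edges n"
  let ?N = "real (n choose 2)" and ?l = "card E"
  have N: "?N > 0" using assms(3) by (simp add: zero_less_binomial)
  have "complete_edges n \<noteq> {}"
    using N card_complete_edges[of n] by auto
  then obtain e where e: "e \<in> ?K" by auto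
  \<comment> \<open>The value does not depend on the chosen \<open>e\<close>: by \<open>deg\<close>
    it is determined after multiplication by \<open>?N\<close>, which can be cancelled.\<close>
  define d where "d = real (card {A \<in> ?S. e \<in> snd A})"
  have deg: "real (card {A \<in> ?S. e' \<in> snd A}) * ?N = real (card ?S * ?l)" if "e' \<in> ?K" for e'
    unfolding of_nat_mult[symmetric] card_copies_containing[OF assms(1) that] ..
  have d: "real (card {A \<in> ?S. e' \<in> snd A}) = d" if "e' \<in> ?K" for e'
  proof -
    have "real (card {A \<in> ?S. e' \<in> snd A}) * ?N = d * ?N"
      unfolding d_def deg[OF that] deg[OF e] ..
    with N show ?thesis by simp
  qed
  have "(\<Sum>k=0..?l. C_pairs V E k n * real k) = (\<Sum>A\<in>?S. \<Sum>B\<in>?S. real (card (snd A \<inter> snd B)))"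
    by (rule sum_pairs_of_copies[OF assms(1), symmetric])
  also have "\<dots> = (\<Sum>e'\<in>?K. (real (card {A \<in> ?S. e' \<in> snd A}))\<^sup>2)"
    using arg_cong[OF sum_card_inter_copies, of real] by simp
  also have "\<dots> = ?N * d\<^sup>2"
    using d by (simp add: card_complete_edges)
  finally have sum_k: "(\<Sum>k=0..?l. C_pairs V E k n * real k) = ?N * d\<^sup>2" .
  have cov: "covariance (random_graph n p) (num_copies V E n) num_edges = ?N * d * (p ^ ?l * (1 - p))"
    using covariance_num_copies_num_edges[OF assms(1), of p n] deg[OF e] assms(4,5)
    by (simp add: d_def mult.commute)
  have var: "measure_pmf.variance (random_graph n p) num_edges = ?N * (p * (1 - p))"
    using assms by (intro variance_num_edges) auto
  obtain l' where l': "?l = Suc l'" using assms(2) gr0_implies_Suc by blast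
  \<comment> \<open>The right-hand side is what remains of the squared covariance over the edge
    variance once \<open>?N * d\<^sup>2\<close> is taken out.\<close>
  have pows: "p ^ (2 * ?l - 1) - p ^ (2 * ?l) = (p ^ ?l)\<^sup>2 * (1 - p) / p"
  proof -
    have "p ^ (2 * ?l) = p\<^sup>2 * (p ^ l')\<^sup>2" "p ^ (2 * ?l - 1) = p * (p ^ l')\<^sup>2"
      by (simp_all add: l' power2_eq_square mult_2 power_add)
    with assms(4) show ?thesis by (simp add: l' field_simps power2_eq_square)
  qed
  have "(?N * d * (p ^ ?l * (1 - p)))\<^sup>2 / (?N * (p * (1 - p)))
    = ?N * d\<^sup>2 * (p ^ (2 * ?l - 1) - p ^ (2 * ?l))"
    unfolding pows using N assms(4,5) by (simp add: field_simps power2_eq_square)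
  also have "\<dots> = (\<Sum>k=0..?l. C_pairs V E k n * (real k * (p ^ (2 * ?l - 1) - p ^ (2 * ?l))))"
    unfolding sum_k[symmetric] sum_distrib_right by (simp add: mult.assoc)
  finally show ?thesis
    unfolding resvar_T_def cov var
    using variance_T_eq[OF assms(1), of p n] assms(4,5)
    by (simp add: right_diff_distrib sum_subtractf)
qed

section \<open>Small overlaps and the asymptotic estimates\<close>

lemma C_pairs_eq_0:
  assumes "simple_graph V E" "card E < k"
  shows "C_pairs V E k n = 0"
proof -
  have "card (snd A \<inter> snd B) \<noteq> k" if "A \<in> copies V E n (complete_edges n)" for A B
    using copies_D(5,7)[OF assms(1) that] card_mono[of "snd A" "snd A \<inter> snd B"] assms(2) by auto
  then have "{(A, B). A \<in> copies V E n (complete_edges n) \<and> B \<in> copies V E n (complete_edges n)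
      \<and> card (snd A \<inter> snd B) = k} = {}"
    by blast
  then show ?thesis unfolding C_pairs_def by (simp only: card.empty of_nat_0)
qed

text \<open>The last assumption covers \<open>l = 2\<close>, where index 3 lies outside the range
  although \<open>f 3\<close> still appears on the right. For the residual variance this value is
  zero by \<open>C_pairs_eq_0\<close>.\<close>

lemma sum_split_first_four:
  fixes f :: "nat \<Rightarrow> real"
  assumes "f 0 = 0" "f 1 = 0" "2 \<le> l" "l < 3 \<Longrightarrow> f 3 = 0"
  shows "(\<Sum>k=0..l. f k) = f 2 + f 3 + (\<Sum>k=4..l. f k)"
proof -
  have "(\<Sum>k=0..l. f k) = f 0 + (f 1 + (f 2 + (\<Sum>k=3..l. f k)))"
    using assms(3) by (simp add: sum.atLeast_Suc_atMost numeral_2_eq_2 numeral_3_eq_3)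
  also have "(\<Sum>k=3..l. f k) = f 3 + (\<Sum>k=4..l. f k)"
    using assms(4) sum.atLeast_Suc_atMost[of 3 l f] by (cases "3 \<le> l") auto
  finally show ?thesis using assms by simp
qed

text \<open>Two vertices span at most one edge. The bound makes \<open>V\<close> nonempty, allows
  writing \<open>v = m + 2\<close>, and gives \<open>n \<ge> 2\<close> whenever
  \<open>n \<ge> v\<close>.\<close>

lemma card_V_ge_3:
  assumes "simple_graph V E" "card E > 1"
  shows "card V \<ge> 3"
proof (rule ccontr)
  assume "\<not> card V \<ge> 3"
  then have "card V choose 2 \<le> 2 choose 2"
    by (intro binomial_right_mono) simp
  moreover have "card E \<le> card V choose 2"
    using assms(1) card_mono[OF finite_imp_finite_nsets, of V E 2] by (simp add: simple_graph_def card_nsets)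
  ultimately show False using assms(2) by simp
qed

theorem theorem2p1:
  fixes V :: "'a set" and E :: "'a set set" and v l :: nat and p :: real
  assumes "simple_graph V E"
    and "card V = v"
    and "card E = l"
    and "l > 1"
    and "\<forall>x\<in>V. \<exists>e\<in>E. x \<in> e"
    and "0 < p" and "p < 1"
  shows
    "(\<forall>n\<ge>v. expectation_T V E p n = c_copies V E n * p ^ l)
     \<and> (\<lambda>n. expectation_T V E p n
            - 1 / real (card (automorphisms V E))
              * (real n ^ v - real v * (real v - 1) / 2 * real n ^ (v - 1)) * p ^ l)
         \<in> O(\<lambda>n. real n ^ (v - 2))
     \<and> (\<forall>n\<ge>v. variance_T V E p n
            = (\<Sum>k=0..l. C_pairs V E k n * (p ^ (2 * l - k) - p ^ (2 * l))))
     \<and> (\<lambda>n. variance_T V E p n) \<in> O(\<lambda>n. real n ^ (2 * v - 2))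
     \<and> (\<forall>n\<ge>v. resvar_T V E p n
            = (\<Sum>k=0..l. C_pairs V E k n
                * (p ^ (2 * l - k) - p ^ (2 * l) - real k * (p ^ (2 * l - 1) - p ^ (2 * l)))))
     \<and> (\<lambda>n. resvar_T V E p n
            - (C_pairs V E 2 n * p ^ (2 * l - 2) * (1 - p)\<^sup>2
               + C_pairs V E 3 n * p ^ (2 * l - 3) * (1 - 3 * p\<^sup>2 + 2 * p ^ 3)))
         \<in> O(\<lambda>n. real n ^ (2 * v - 4))
     \<and> (\<lambda>n. resvar_T V E p n) \<in> O(\<lambda>n. real n ^ (2 * v - 3))"
proof (intro conjI allI impI)
  note G = assms(1) and E = assms(3)
  let ?a = "real (card (automorphisms V E))"
  have p: "0 \<le> p" "p \<le> 1" using assms(6,7) by auto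
  have v: "v \<ge> 3" using card_V_ge_3[OF G] assms(2,3,4) by simp
  then have V: "V \<noteq> {}" using assms(2) by auto
  \<comment> \<open>Three thresholds are used: \<open>j = 2\<close> for \<open>k \<ge> 1\<close>,
    \<open>j = 3\<close> for \<open>k \<ge> 2\<close> and \<open>j = 4\<close> for
    \<open>k \<ge> 4\<close>. Since three vertices span up to three edges, overlaps of 2 and 3 edges
    get the weaker bound and are kept as separate terms.\<close>
  have C: "(\<lambda>n. C_pairs V E k n * c) \<in> O(\<lambda>n. real n ^ (2 * v - j))" if "(j - 1) choose 2 < k" for j k c
    using landau_o.big.mult[OF C_pairs_bigo[OF G V that], of "\<lambda>_. c" "\<lambda>_. 1"] assms(2) by simp
  have mono: "(\<lambda>n. real n ^ i) \<in> O(\<lambda>n. real n ^ j)" if "i \<le> j" for i j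
    using that by (intro bigoI[of _ 1] eventually_sequentiallyI[of 1]) (simp add: power_increasing)
  show "expectation_T V E p n = c_copies V E n * p ^ l" for n
    using expectation_T_eq[OF G p] E by simp
  show "(\<lambda>n. expectation_T V E p n - 1 / ?a
      * (real n ^ v - real v * (real v - 1) / 2 * real n ^ (v - 1)) * p ^ l) \<in> O(\<lambda>n. real n ^ (v - 2))"
  proof -
    obtain m where m: "v = m + 2" using that[of "v - 2"] v by simp
    then have m1: "v - 1 = m + 1" by simp
    have factor: "X / ?a * c - 1 / ?a * Y * c = c / ?a * (X - Y)" for X Y c :: real
      by (simp add: right_diff_distrib diff_divide_distrib mult.commute)
    have "(\<lambda>n. p ^ l / ?a * ((\<Prod>i<m + 2. real n - real i)
      - (real n ^ (m + 2) - real (m + 2) * (real (m + 2) - 1) / 2 * real n ^ (m + 1))))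
      \<in> O(\<lambda>n. real n ^ m)"
      by (intro landau_o.big.cmult_in_iff[THEN iffD2] falling_factorial_bigo)
        (use card_automorphisms_pos[of V E] G assms(6) in \<open>simp_all add: simple_graph_def\<close>)
    moreover have "expectation_T V E p n - 1 / ?a
        * (real n ^ v - real v * (real v - 1) / 2 * real n ^ (v - 1)) * p ^ l
      = p ^ l / ?a * ((\<Prod>i<m + 2. real n - real i)
      - (real n ^ (m + 2) - real (m + 2) * (real (m + 2) - 1) / 2 * real n ^ (m + 1)))" for n
      unfolding expectation_T_eq[OF G p] E c_copies_def assms(2) m1 factor
      unfolding m ..
    ultimately show ?thesis by (simp add: m)
  qed
  have Var: "variance_T V E p n = (\<Sum>k=0..l. C_pairs V E k n * (p ^ (2 * l - k) - p ^ (2 * l)))" for n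
    using variance_T_eq[OF G p] E by simp
  then show "variance_T V E p n = (\<Sum>k=0..l. C_pairs V E k n * (p ^ (2 * l - k) - p ^ (2 * l)))" for n .
  show "(\<lambda>n. variance_T V E p n) \<in> O(\<lambda>n. real n ^ (2 * v - 2))"
    unfolding Var
  proof (rule big_sum_in_bigo)
    fix k
    show "(\<lambda>n. C_pairs V E k n * (p ^ (2 * l - k) - p ^ (2 * l))) \<in> O(\<lambda>n. real n ^ (2 * v - 2))"
    \<comment> \<open>Disjoint edge sets have coefficient zero; any shared edge gives two shared
      vertices, so \<open>j = 2\<close> applies.\<close>
    proof (cases "k = 0")
      case False
      then show ?thesis by (intro C) (simp add: numeral_eq_Suc)
    qed simp
  qed
  define r where "r k = p ^ (2 * l - k) - p ^ (2 * l) - real k * (p ^ (2 * l - 1) - p ^ (2 * l))" for k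
  have Res: "resvar_T V E p n = (\<Sum>k=0..l. C_pairs V E k n * r k)" if "n \<ge> v" for n
    using resvar_T_eq[OF G _ _ assms(6,7), of n] E assms(4) v that by (simp add: r_def)
  then show "resvar_T V E p n = (\<Sum>k=0..l. C_pairs V E k n
      * (p ^ (2 * l - k) - p ^ (2 * l) - real k * (p ^ (2 * l - 1) - p ^ (2 * l))))" if "n \<ge> v" for n
    using that by (simp add: r_def)
  \<comment> \<open>Subtracting the linear term also kills the coefficient at \<open>k = 1\<close>,
    so only overlaps of at least two edges remain; this lowers the exponent from
    \<open>2 * v - 2\<close> to \<open>2 * v - 3\<close>.\<close>
  have r01: "r 0 = 0" "r 1 = 0" by (simp_all add: r_def)
  have r2: "r 2 = p ^ (2 * l - 2) * (1 - p)\<^sup>2"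
  proof -
    obtain m where "l = m + 2" using that[of "l - 2"] assms(4) by simp
    then show ?thesis by (simp add: r_def power2_eq_square algebra_simps)
  qed
  have r3: "r 3 = p ^ (2 * l - 3) * (1 - 3 * p\<^sup>2 + 2 * p ^ 3)"
  proof -
    \<comment> \<open>This suffices even for \<open>l = 2\<close>: the exponent
      \<open>2 * l - 3\<close> equals \<open>2 * m + 1\<close>, without truncation.\<close>
    obtain m where "l = m + 2" using that[of "l - 2"] assms(4) by simp
    then show ?thesis by (simp add: r_def power2_eq_square power3_eq_cube algebra_simps)
  qed
  have split: "(\<Sum>k=0..l. C_pairs V E k n * r k)
    = C_pairs V E 2 n * r 2 + C_pairs V E 3 n * r 3 + (\<Sum>k=4..l. C_pairs V E k n * r k)" for n
    using assms(4) r01 C_pairs_eq_0[OF G, of 3 n] E by (intro sum_split_first_four) auto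
  have tail: "(\<lambda>n. \<Sum>k=4..l. C_pairs V E k n * r k) \<in> O(\<lambda>n. real n ^ (2 * v - 4))"
  proof (rule big_sum_in_bigo)
    fix k assume "k \<in> {4..l}"
    then show "(\<lambda>n. C_pairs V E k n * r k) \<in> O(\<lambda>n. real n ^ (2 * v - 4))"
      by (intro C) (simp add: numeral_eq_Suc)
  qed
  \<comment> \<open>The exact formula for the residual variance is at hand for
    \<open>n \<ge> v\<close>, which is enough for both remaining asymptotic claims.\<close>
  have ev: "\<forall>\<^sub>F n in sequentially. n \<ge> v" by (rule eventually_ge_at_top)
  show "(\<lambda>n. resvar_T V E p n
            - (C_pairs V E 2 n * p ^ (2 * l - 2) * (1 - p)\<^sup>2
               + C_pairs V E 3 n * p ^ (2 * l - 3) * (1 - 3 * p\<^sup>2 + 2 * p ^ 3)))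
         \<in> O(\<lambda>n. real n ^ (2 * v - 4))"
  proof (subst landau_o.big.in_cong)
    show "\<forall>\<^sub>F n in sequentially. resvar_T V E p n
            - (C_pairs V E 2 n * p ^ (2 * l - 2) * (1 - p)\<^sup>2
               + C_pairs V E 3 n * p ^ (2 * l - 3) * (1 - 3 * p\<^sup>2 + 2 * p ^ 3))
        = (\<Sum>k=4..l. C_pairs V E k n * r k)"
      using ev by eventually_elim (simp add: Res split r2 r3)
  qed (rule tail)
  show "(\<lambda>n. resvar_T V E p n) \<in> O(\<lambda>n. real n ^ (2 * v - 3))"
  proof (subst landau_o.big.in_cong)
    show "\<forall>\<^sub>F n in sequentially. resvar_T V E p n
        = C_pairs V E 2 n * r 2 + C_pairs V E 3 n * r 3 + (\<Sum>k=4..l. C_pairs V E k n * r k)"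
      using ev by eventually_elim (simp only: Res split)
    have "(\<lambda>n. C_pairs V E 2 n * r 2) \<in> O(\<lambda>n. real n ^ (2 * v - 3))"
      "(\<lambda>n. C_pairs V E 3 n * r 3) \<in> O(\<lambda>n. real n ^ (2 * v - 3))"
      by (intro C, simp add: numeral_eq_Suc)+
    moreover have "(\<lambda>n. \<Sum>k=4..l. C_pairs V E k n * r k) \<in> O(\<lambda>n. real n ^ (2 * v - 3))"
      by (rule landau_o.big_trans[OF tail mono]) simp
    ultimately show "(\<lambda>n. C_pairs V E 2 n * r 2 + C_pairs V E 3 n * r 3
        + (\<Sum>k=4..l. C_pairs V E k n * r k)) \<in> O(\<lambda>n. real n ^ (2 * v - 3))"
      by (intro sum_in_bigo)
  qed
qed

end
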